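(* Let $\mathbb X$ be a Cauchy cocomplete normed category, and let $F:\mathbb X\to\mathbb X$ be a contractive functor which preserves (ordinary) colimits of sequences. If $\mathbb X$ contains any morphism $f:x\to Fx$ with $|f|<\infty$, then $\mathbb X$ contains a forward fixed point of $F$, and even a fixed point of $F$ if $F$ preserves normed colimits of Cauchy sequences; in particular, $\mathbb X$ contains a fixed point of $F$ if $\mathbb X$ is forward symmetric or backward symmetric.
   Context: A normed category is a category $\mathbb X$ with a value $|f|\in[0,\infty]$ for every morphism $f$ such that $|1_x|=0$ and $|g\cdot f|\le|f|+|g|$ for all objects $x$ and composable $f,g$. A functor $F:\mathbb X\to\mathbb X$ is contractive if there is a real $L$ with $0\le L<1$ and $|Fh|\le L|h|$ for all morphisms $h$ in $\mathbb X$ (with the convention $L\cdot\infty=\infty$, also for $L=0$). A sequence in $\mathbb X$ is a functor $s:\mathbb N\to\mathbb X$ from the ordered set $\mathbb N$, written $s=(s_{m,n}:x_m\to x_n)_{m\le n}$. It is Cauchy if $\inf_{N}\sup_{n\ge m\ge N}|s_{m,n}|=0$. A normed colimit of $s$ is an object $x$ with a cocone $\gamma=(\gamma_n:x_n\to x)_n$ which is a colimit cocone of $s$ in the ordinary category $\mathbb X$ such that, for every morphism $f$ with domain $x$, $|f|=\inf_{N}\sup_{n\ge N}|f\cdot\gamma_n|$. $\mathbb X$ is Cauchy cocomplete if every Cauchy sequence in $\mathbb X$ has a normed colimit in $\mathbb X$. $F$ preserves normed colimits of Cauchy sequences if, whenever $x$ with $\gamma$ is a normed colimit of a Cauchy sequence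 $s$, $Fx$ with $F\gamma$ is a normed colimit of $Fs$. An object $x$ is a forward fixed point of $F$ if there is an isomorphism $f:x\to Fx$ of the ordinary category $\mathbb X$ with $|f|=0$. It is a fixed point of $F$ if there is an isomorphism $f:x\to Fx$ with $|f|=0=|f^{-1}|$. $\mathbb X$ is forward symmetric if $|f|\le|f\cdot h|+|h|$ for all composable $h$ and $f$. It is backward symmetric if $|f|\le|g\cdot f|+|g|$ for all composable $f$ and $g$. *)

theory Defs
  imports "HOL-Library.Extended_Nonnegative_Real"
begin

section \<open>Categories and functors\<close>

record ('o, 'm) cat =
  Obj :: "'o set"
  Arr :: "'m set"
  Dom :: "'m \<Rightarrow> 'o"
  Cod :: "'m \<Rightarrow> 'o"
  Ide :: "'o \<Rightarrow> 'm"
  Comp :: "'m \<Rightarrow> 'm \<Rightarrow> 'm"  (infixr "\<cdot>\<index>" 70)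

definition hom :: "('o, 'm, 'z) cat_scheme \<Rightarrow> 'o \<Rightarrow> 'o \<Rightarrow> 'm set" where
  "hom C a b = {f \<in> Arr C. Dom C f = a \<and> Cod C f = b}"

text \<open>Composition is written in applicative order: \<open>g \<cdot> f\<close> means first \<open>f\<close>, then \<open>g\<close>.\<close>

locale category =
  fixes C :: "('o, 'm, 'z) cat_scheme" (structure)
  assumes Dom_in_Obj: "f \<in> Arr C \<Longrightarrow> Dom C f \<in> Obj C"
    and Cod_in_Obj: "f \<in> Arr C \<Longrightarrow> Cod C f \<in> Obj C"
    and Ide_in_hom: "a \<in> Obj C \<Longrightarrow> Ide C a \<in> hom C a a"
    and Comp_in_hom: "f \<in> hom C a b \<Longrightarrow> g \<in> hom C b c \<Longrightarrow> g \<cdot> f \<in> hom C a c"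
    and Comp_Ide_right: "f \<in> hom C a b \<Longrightarrow> f \<cdot> Ide C a = f"
    and Comp_Ide_left: "f \<in> hom C a b \<Longrightarrow> Ide C b \<cdot> f = f"
    and Comp_assoc: "f \<in> hom C a b \<Longrightarrow> g \<in> hom C b c \<Longrightarrow> h \<in> hom C c d \<Longrightarrow>
                       (h \<cdot> g) \<cdot> f = h \<cdot> (g \<cdot> f)"

definition inverse_arrows :: "('o, 'm, 'z) cat_scheme \<Rightarrow> 'm \<Rightarrow> 'm \<Rightarrow> bool" where
  "inverse_arrows C f g \<longleftrightarrow>
     f \<in> Arr C \<and> g \<in> hom C (Cod C f) (Dom C f) \<and>
     g \<cdot>\<^bsub>C\<^esub> f = Ide C (Dom C f) \<and> f \<cdot>\<^bsub>C\<^esub> g = Ide C (Cod C f)"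

definition iso_arr :: "('o, 'm, 'z) cat_scheme \<Rightarrow> 'm \<Rightarrow> bool" where
  "iso_arr C f \<longleftrightarrow> (\<exists>g. inverse_arrows C f g)"

record ('o1, 'm1, 'o2, 'm2) fnctr =
  OMap :: "'o1 \<Rightarrow> 'o2"
  AMap :: "'m1 \<Rightarrow> 'm2"

definition is_functor ::
  "('o1, 'm1, 'y) cat_scheme \<Rightarrow> ('o2, 'm2, 'z) cat_scheme \<Rightarrow> ('o1, 'm1, 'o2, 'm2) fnctr \<Rightarrow> bool" where
  "is_functor C D F \<longleftrightarrow>
     (\<forall>a \<in> Obj C. OMap F a \<in> Obj D) \<and>
     (\<forall>f \<in> Arr C. AMap F f \<in> hom D (OMap F (Dom C f)) (OMap F (Cod C f))) \<and>
     (\<forall>a \<in> Obj C. AMap F (Ide C a) = Ide D (OMap F a)) \<and>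
     (\<forall>f \<in> Arr C. \<forall>g \<in> Arr C. Dom C g = Cod C f \<longrightarrow>
        AMap F (g \<cdot>\<^bsub>C\<^esub> f) = AMap F g \<cdot>\<^bsub>D\<^esub> AMap F f)"

definition fcomp ::
  "('o2, 'm2, 'o3, 'm3) fnctr \<Rightarrow> ('o1, 'm1, 'o2, 'm2) fnctr \<Rightarrow> ('o1, 'm1, 'o3, 'm3) fnctr" where
  "fcomp G F = \<lparr>OMap = OMap G \<circ> OMap F, AMap = AMap G \<circ> AMap F\<rparr>"


section \<open>Sequences and their colimits\<close>

text \<open>The ordered set of natural numbers as a category: the unique arrow from \<open>m\<close> to \<open>n\<close>,
  for \<open>m \<le> n\<close>, is the pair \<open>(m, n)\<close>.\<close>

definition nat_cat :: "(nat, nat \<times> nat) cat" where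
  "nat_cat = \<lparr>Obj = UNIV, Arr = {(m, n). m \<le> n}, Dom = fst, Cod = snd,
              Ide = (\<lambda>n. (n, n)), Comp = (\<lambda>g f. (fst f, snd g))\<rparr>"

lemma category_nat_cat: "category nat_cat"
  by unfold_locales (auto simp: nat_cat_def hom_def)

type_synonym ('o, 'm) sequence = "(nat, nat \<times> nat, 'o, 'm) fnctr"

abbreviation is_sequence :: "('o, 'm, 'z) cat_scheme \<Rightarrow> ('o, 'm) sequence \<Rightarrow> bool" where
  "is_sequence C s \<equiv> is_functor nat_cat C s"

definition is_cocone ::
  "('o, 'm, 'z) cat_scheme \<Rightarrow> ('o, 'm) sequence \<Rightarrow> 'o \<Rightarrow> (nat \<Rightarrow> 'm) \<Rightarrow> bool" where
  "is_cocone C s x \<gamma> \<longleftrightarrow>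
     x \<in> Obj C \<and> (\<forall>n. \<gamma> n \<in> hom C (OMap s n) x) \<and>
     (\<forall>m n. m \<le> n \<longrightarrow> \<gamma> n \<cdot>\<^bsub>C\<^esub> AMap s (m, n) = \<gamma> m)"

definition is_colimit ::
  "('o, 'm, 'z) cat_scheme \<Rightarrow> ('o, 'm) sequence \<Rightarrow> 'o \<Rightarrow> (nat \<Rightarrow> 'm) \<Rightarrow> bool" where
  "is_colimit C s x \<gamma> \<longleftrightarrow>
     is_cocone C s x \<gamma> \<and>
     (\<forall>y \<delta>. is_cocone C s y \<delta> \<longrightarrow> (\<exists>!h. h \<in> hom C x y \<and> (\<forall>n. h \<cdot>\<^bsub>C\<^esub> \<gamma> n = \<delta> n)))"

definition preserves_sequence_colimits ::
  "('o, 'm, 'z) cat_scheme \<Rightarrow> ('o, 'm, 'o, 'm) fnctr \<Rightarrow> bool" where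
  "preserves_sequence_colimits C F \<longleftrightarrow>
     (\<forall>s x \<gamma>. is_sequence C s \<longrightarrow> is_colimit C s x \<gamma> \<longrightarrow>
        is_colimit C (fcomp F s) (OMap F x) (\<lambda>n. AMap F (\<gamma> n)))"


section \<open>Normed categories\<close>

record ('o, 'm) ncat = "('o, 'm) cat" +
  nrm :: "'m \<Rightarrow> ennreal"

locale normed_category = category X
  for X :: "('o, 'm, 'z) ncat_scheme" (structure) +
  assumes nrm_Ide: "x \<in> Obj X \<Longrightarrow> nrm X (Ide X x) = 0"
    and nrm_Comp: "f \<in> hom X x y \<Longrightarrow> g \<in> hom X y z \<Longrightarrow> nrm X (g \<cdot> f) \<le> nrm X f + nrm X g"

text \<open>In \<^typ>\<open>ennreal\<close> one has \<open>0 * \<infinity> = 0\<close>, whereas contractivity uses the convention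
  \<open>L * \<infinity> = \<infinity>\<close> for all \<open>L\<close>, including \<open>L = 0\<close>; hence the case distinction.\<close>

definition contractive ::
  "('o, 'm, 'z) ncat_scheme \<Rightarrow> ('o, 'm, 'o, 'm) fnctr \<Rightarrow> bool" where
  "contractive X F \<longleftrightarrow>
     (\<exists>L::real. 0 \<le> L \<and> L < 1 \<and>
        (\<forall>h \<in> Arr X. nrm X (AMap F h) \<le> (if nrm X h = \<infinity> then \<infinity> else ennreal L * nrm X h)))"

definition is_Cauchy :: "('o, 'm, 'z) ncat_scheme \<Rightarrow> ('o, 'm) sequence \<Rightarrow> bool" where
  "is_Cauchy X s \<longleftrightarrow>
     is_sequence X s \<and>
     (INF N::nat. SUP (m, n) \<in> {(m, n). N \<le> m \<and> m \<le> n}. nrm X (AMap s (m, n))) = 0"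

definition is_normed_colimit ::
  "('o, 'm, 'z) ncat_scheme \<Rightarrow> ('o, 'm) sequence \<Rightarrow> 'o \<Rightarrow> (nat \<Rightarrow> 'm) \<Rightarrow> bool" where
  "is_normed_colimit X s x \<gamma> \<longleftrightarrow>
     is_colimit X s x \<gamma> \<and>
     (\<forall>f \<in> Arr X. Dom X f = x \<longrightarrow>
        nrm X f = (INF N::nat. SUP n \<in> {N..}. nrm X (f \<cdot>\<^bsub>X\<^esub> \<gamma> n)))"

definition Cauchy_cocomplete :: "('o, 'm, 'z) ncat_scheme \<Rightarrow> bool" where
  "Cauchy_cocomplete X \<longleftrightarrow> (\<forall>s. is_Cauchy X s \<longrightarrow> (\<exists>x \<gamma>. is_normed_colimit X s x \<gamma>))"

definition preserves_Cauchy_normed_colimits ::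
  "('o, 'm, 'z) ncat_scheme \<Rightarrow> ('o, 'm, 'o, 'm) fnctr \<Rightarrow> bool" where
  "preserves_Cauchy_normed_colimits X F \<longleftrightarrow>
     (\<forall>s x \<gamma>. is_Cauchy X s \<longrightarrow> is_normed_colimit X s x \<gamma> \<longrightarrow>
        is_normed_colimit X (fcomp F s) (OMap F x) (\<lambda>n. AMap F (\<gamma> n)))"

definition forward_fixed_point ::
  "('o, 'm, 'z) ncat_scheme \<Rightarrow> ('o, 'm, 'o, 'm) fnctr \<Rightarrow> 'o \<Rightarrow> bool" where
  "forward_fixed_point X F x \<longleftrightarrow>
     x \<in> Obj X \<and> (\<exists>f \<in> hom X x (OMap F x). iso_arr X f \<and> nrm X f = 0)"

definition fixed_point ::
  "('o, 'm, 'z) ncat_scheme \<Rightarrow> ('o, 'm, 'o, 'm) fnctr \<Rightarrow> 'o \<Rightarrow> bool" where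
  "fixed_point X F x \<longleftrightarrow>
     x \<in> Obj X \<and>
     (\<exists>f \<in> hom X x (OMap F x). \<exists>g. inverse_arrows X f g \<and> nrm X f = 0 \<and> nrm X g = 0)"

definition forward_symmetric :: "('o, 'm, 'z) ncat_scheme \<Rightarrow> bool" where
  "forward_symmetric X \<longleftrightarrow>
     (\<forall>h \<in> Arr X. \<forall>f \<in> Arr X. Dom X f = Cod X h \<longrightarrow> nrm X f \<le> nrm X (f \<cdot>\<^bsub>X\<^esub> h) + nrm X h)"

definition backward_symmetric :: "('o, 'm, 'z) ncat_scheme \<Rightarrow> bool" where
  "backward_symmetric X \<longleftrightarrow>
     (\<forall>f \<in> Arr X. \<forall>g \<in> Arr X. Dom X g = Cod X f \<longrightarrow> nrm X f \<le> nrm X (g \<cdot>\<^bsub>X\<^esub> f) + nrm X g)"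

end

theory Submission
  imports Defs
begin

text \<open>
  As in Banach's fixed point theorem one iterates \<open>F\<close> on \<open>f\<close>. The morphisms \<open>F\<^sup>n f\<close> have
  norms bounded by a geometric sequence, so the sequence
  \<open>x \<rightarrow> F x \<rightarrow> F\<^sup>2 x \<rightarrow> \<dots>\<close> is Cauchy and has a normed colimit \<open>(z, \<gamma>)\<close>, where
  \<open>|\<gamma>\<^sub>n| \<longlonglongrightarrow> 0\<close> because \<open>|1\<^sub>z| = 0\<close>. As \<open>F\<close> maps the sequence to its own shift, preservation of
  the colimit gives, as in Adamek's theorem, an isomorphism \<open>h : z \<rightarrow> F z\<close> with
  \<open>h \<cdot> \<gamma>\<^sub>n = F \<gamma>\<^sub>n \<cdot> F\<^sup>n f\<close>; these norms tend to \<open>0\<close>, hence \<open>|h| = 0\<close>. The inverse \<open>k\<close> satisfies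
  \<open>k \<cdot> F \<gamma>\<^sub>n = \<gamma>\<^sub>n\<^sub>+\<^sub>1\<close>, so \<open>|k| = 0\<close> as soon as \<open>F z\<close> is a normed colimit. Under either symmetry
  condition, \<open>|k| \<le> |1| + |h| = 0\<close>.
\<close>

section \<open>Convergence to 0 in \<open>ennreal\<close>\<close>

lemma INF_SUP_eq_0_iff_tendsto_0:
  fixes u :: "nat \<Rightarrow> ennreal"
  shows "(INF N. SUP n\<in>{N..}. u n) = 0 \<longleftrightarrow> u \<longlonglongrightarrow> 0"
proof -
  have eq: "(INF N. SUP n\<in>{N..}. u n) = limsup u"
    by (simp add: limsup_INF_SUP atLeast_def)
  show ?thesis
  proof
    assume "(INF N. SUP n\<in>{N..}. u n) = 0"
    then have "limsup u = 0" using eq by simp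
    \<comment> \<open>Values in \<open>ennreal\<close> are nonnegative, so the liminf is squeezed
      between 0 and the limsup.\<close>
    moreover from this have "liminf u = 0"
      using Liminf_le_Limsup[of sequentially u] by simp
    ultimately show "u \<longlonglongrightarrow> 0"
      by (intro Liminf_eq_Limsup) simp_all
  next
    assume "u \<longlonglongrightarrow> 0"
    then show "(INF N. SUP n\<in>{N..}. u n) = 0"
      unfolding eq by (intro lim_imp_Limsup) simp_all
  qed
qed

lemma tendsto_0_ennreal_mono:
  fixes u v :: "nat \<Rightarrow> ennreal"
  assumes "v \<longlonglongrightarrow> 0" and "\<forall>\<^sub>F n in sequentially. u n \<le> v n"
  shows "u \<longlonglongrightarrow> 0"
  by (rule tendsto_sandwich[OF _ assms(2) tendsto_const assms(1)]) simp

section \<open>Functors in terms of hom-sets, and their iterates\<close>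

lemma is_functorD:
  assumes "is_functor C D F"
  shows "a \<in> Obj C \<Longrightarrow> OMap F a \<in> Obj D"
    and "f \<in> hom C a b \<Longrightarrow> AMap F f \<in> hom D (OMap F a) (OMap F b)"
    and "a \<in> Obj C \<Longrightarrow> AMap F (Ide C a) = Ide D (OMap F a)"
    and "f \<in> hom C a b \<Longrightarrow> g \<in> hom C b c \<Longrightarrow> AMap F (g \<cdot>\<^bsub>C\<^esub> f) = AMap F g \<cdot>\<^bsub>D\<^esub> AMap F f"
  using assms by (auto simp: is_functor_def hom_def)

lemma iterate_in_hom:
  assumes "is_functor C C F" and "f \<in> hom C x (OMap F x)"
  shows "(AMap F ^^ n) f \<in> hom C ((OMap F ^^ n) x) ((OMap F ^^ Suc n) x)"
  by (induction n) (use assms is_functorD(2)[OF assms(1)] in simp_all)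

section \<open>Sequences generated by their consecutive steps\<close>

primrec chain :: "('o, 'm, 'z) cat_scheme \<Rightarrow> (nat \<Rightarrow> 'o) \<Rightarrow> (nat \<Rightarrow> 'm) \<Rightarrow> nat \<Rightarrow> nat \<Rightarrow> 'm" where
  "chain C p a m 0 = Ide C (p m)"
| "chain C p a m (Suc k) = a (m + k) \<cdot>\<^bsub>C\<^esub> chain C p a m k"

text \<open>Since \<open>chain\<close> takes a start and a length, a transition arrow is found from
  \<open>n - m\<close>. For \<open>m > n\<close> the truncated difference yields an identity, but
  such pairs are not arrows of \<open>nat_cat\<close>.\<close>

definition seq_of_steps ::
  "('o, 'm, 'z) cat_scheme \<Rightarrow> (nat \<Rightarrow> 'o) \<Rightarrow> (nat \<Rightarrow> 'm) \<Rightarrow> ('o, 'm) sequence" where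
  "seq_of_steps C p a = \<lparr>OMap = p, AMap = (\<lambda>(m, n). chain C p a m (n - m))\<rparr>"

lemma seq_of_steps_simps [simp]:
  "OMap (seq_of_steps C p a) = p"
  "AMap (seq_of_steps C p a) (m, n) = chain C p a m (n - m)"
  by (simp_all add: seq_of_steps_def)

context category
begin

lemma Obj_of_hom:
  assumes "f \<in> hom C a b" shows "a \<in> Obj C" and "b \<in> Obj C"
  using assms Dom_in_Obj Cod_in_Obj by (auto simp: hom_def)

context
  fixes p :: "nat \<Rightarrow> 'o" and a :: "nat \<Rightarrow> 'm"
  assumes step: "\<And>n. a n \<in> hom C (p n) (p (Suc n))"
begin

lemma chain_in_hom: "chain C p a m k \<in> hom C (p m) (p (m + k))"
proof (induction k)
  case 0
  show ?case using Ide_in_hom[OF Obj_of_hom(1)[OF step]] by simp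
next
  case (Suc k)
  show ?case using Comp_in_hom[OF Suc step] by simp
qed

text \<open>This is functoriality of the generated sequence, stated with lengths so that no order
  conditions arise.\<close>

lemma chain_add: "chain C p a m (j + k) = chain C p a (m + j) k \<cdot> chain C p a m j"
proof (induction k)
  case 0
  show ?case using Comp_Ide_left[OF chain_in_hom] by simp
next
  case (Suc k)
  have "chain C p a m (j + Suc k) = a (m + j + k) \<cdot> (chain C p a (m + j) k \<cdot> chain C p a m j)"
    by (simp add: Suc add.assoc)
  also have "\<dots> = chain C p a (m + j) (Suc k) \<cdot> chain C p a m j"
    using Comp_assoc[OF chain_in_hom chain_in_hom step] by simp
  finally show ?case .
qed

lemma is_sequence_seq_of_steps: "is_sequence C (seq_of_steps C p a)"
proof -
  have hom: "chain C p a m (n - m) \<in> hom C (p m) (p n)" if "m \<le> n" for m n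
    using chain_in_hom[of m "n - m"] that by simp
  have comp: "chain C p a l (n - l) = chain C p a m (n - m) \<cdot> chain C p a l (m - l)"
    if "l \<le> m" "m \<le> n" for l m n
    using chain_add[of l "m - l" "n - m"] that by simp
  show ?thesis
    unfolding is_functor_def
  proof (intro conjI ballI impI)
    show "OMap (seq_of_steps C p a) n \<in> Obj C" for n
      using Obj_of_hom(1)[OF step] by simp
    show "AMap (seq_of_steps C p a) (Ide nat_cat n) = Ide C (OMap (seq_of_steps C p a) n)" for n
      by (simp add: nat_cat_def)
  next
    fix u assume "u \<in> Arr nat_cat"
    then show "AMap (seq_of_steps C p a) u
      \<in> hom C (OMap (seq_of_steps C p a) (Dom nat_cat u)) (OMap (seq_of_steps C p a) (Cod nat_cat u))"
      using hom by (cases u) (simp add: nat_cat_def)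
  next
    fix u v assume "u \<in> Arr nat_cat" "v \<in> Arr nat_cat" "Dom nat_cat v = Cod nat_cat u"
    then show "AMap (seq_of_steps C p a) (v \<cdot>\<^bsub>nat_cat\<^esub> u)
      = AMap (seq_of_steps C p a) v \<cdot> AMap (seq_of_steps C p a) u"
      by (cases u; cases v) (simp add: nat_cat_def, rule comp)
  qed
qed

text \<open>Compatibility with single steps propagates along chains by induction on their
  length.\<close>

lemma is_cocone_seq_of_stepsI:
  assumes "y \<in> Obj C" and leg: "\<And>n. \<gamma> n \<in> hom C (p n) y"
    and comm: "\<And>n. \<gamma> (Suc n) \<cdot> a n = \<gamma> n"
  shows "is_cocone C (seq_of_steps C p a) y \<gamma>"
proof -
  have chain_comm: "\<gamma> (m + k) \<cdot> chain C p a m k = \<gamma> m" for m k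
  proof (induction k)
    case 0
    show ?case using Comp_Ide_right[OF leg] by simp
  next
    case (Suc k)
    show ?case
      using Comp_assoc[OF chain_in_hom[of m k] step leg] comm[of "m + k"] Suc by simp
  qed
  have "\<gamma> n \<cdot> chain C p a m (n - m) = \<gamma> m" if "m \<le> n" for m n
    using chain_comm[of m "n - m"] that by simp
  then show ?thesis
    using assms(1) leg by (simp add: is_cocone_def)
qed

lemma cocone_seq_of_steps_step:
  assumes "is_cocone C (seq_of_steps C p a) y \<gamma>"
  shows "\<gamma> (Suc n) \<cdot> a n = \<gamma> n"
proof -
  have "\<gamma> (Suc n) \<cdot> AMap (seq_of_steps C p a) (n, Suc n) = \<gamma> n"
    using assms by (simp add: is_cocone_def del: seq_of_steps_simps(2))
  \<comment> \<open>A chain of length 1 is \<open>a n\<close> composed with an identity, which still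
    has to be cancelled.\<close>
  then show ?thesis using Comp_Ide_right[OF step] by simp
qed

end

section \<open>Colimits of sequences and the comparison isomorphism\<close>

lemma colimit_factor:
  assumes "is_colimit C s x \<gamma>" and "is_cocone C s y \<delta>"
  obtains h where "h \<in> hom C x y" and "\<And>n. h \<cdot> \<gamma> n = \<delta> n"
proof -
  have "\<exists>!h. h \<in> hom C x y \<and> (\<forall>n. h \<cdot> \<gamma> n = \<delta> n)"
    using assms by (simp add: is_colimit_def)
  then show ?thesis using that by blast
qed

text \<open>Both morphisms factor the cocone with legs \<open>g \<cdot> \<gamma> n\<close>, so the
  uniqueness half of the universal property applies.\<close>

lemma colimit_unique:
  assumes s: "is_sequence C s" and lim: "is_colimit C s x \<gamma>"
    and g: "g \<in> hom C x y" and g': "g' \<in> hom C x y"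
    and eq: "\<And>n. g \<cdot> \<gamma> n = g' \<cdot> \<gamma> n"
  shows "g = g'"
proof -
  have leg: "\<gamma> n \<in> hom C (OMap s n) x" for n
    using lim by (simp add: is_colimit_def is_cocone_def)
  have "(g \<cdot> \<gamma> n) \<cdot> AMap s (m, n) = g \<cdot> \<gamma> m" if "m \<le> n" for m n
  proof -
    have "AMap s (m, n) \<in> hom C (OMap s m) (OMap s n)"
      using is_functorD(2)[OF s, of "(m, n)" m n] that by (simp add: hom_def nat_cat_def)
    from Comp_assoc[OF this leg g] show ?thesis
      using lim that by (simp add: is_colimit_def is_cocone_def)
  qed
  then have "is_cocone C s y (\<lambda>n. g \<cdot> \<gamma> n)"
    using Obj_of_hom(2)[OF g] Comp_in_hom[OF leg g] by (simp add: is_cocone_def)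
  then show ?thesis
    using lim g g' eq unfolding is_colimit_def by metis
qed

text \<open>The equality of records lets a colimit preserved by \<open>F\<close> be read as a
  colimit of the shifted sequence.\<close>

lemma fcomp_seq_of_steps:
  assumes F: "is_functor C C F" and step: "\<And>n. a n \<in> hom C (p n) (p (Suc n))"
    and p: "\<And>n. OMap F (p n) = p (Suc n)" and a: "\<And>n. AMap F (a n) = a (Suc n)"
  shows "fcomp F (seq_of_steps C p a) = seq_of_steps C (p \<circ> Suc) (a \<circ> Suc)"
proof -
  have "AMap F (chain C p a m k) = chain C (p \<circ> Suc) (a \<circ> Suc) m k" for m k
  proof (induction k)
    case 0
    show ?case using is_functorD(3)[OF F Obj_of_hom(1)[OF step]] p by simp
  next
    case (Suc k)
    show ?case
      using is_functorD(4)[OF F chain_in_hom[where p = p and a = a, OF step] step] Suc a by simp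
  qed
  then show ?thesis by (auto simp: fcomp_def seq_of_steps_def p)
qed

text \<open>Precomposing the legs \<open>AMap F (\<gamma> n)\<close> with \<open>a n\<close> gives a
  cocone over the original sequence, which induces \<open>h\<close>; dropping the leg
  \<open>\<gamma> 0\<close> gives one over the shifted sequence, which induces \<open>k\<close>.
  Uniqueness of factorisations makes them inverse.\<close>

lemma sequence_colimit_iso:
  assumes F: "is_functor C C F" and step: "\<And>n. a n \<in> hom C (p n) (p (Suc n))"
    and p: "\<And>n. OMap F (p n) = p (Suc n)" and a: "\<And>n. AMap F (a n) = a (Suc n)"
    and lim: "is_colimit C (seq_of_steps C p a) z \<gamma>"
    and Flim: "is_colimit C (fcomp F (seq_of_steps C p a)) (OMap F z) (\<lambda>n. AMap F (\<gamma> n))"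
  obtains h k where "h \<in> hom C z (OMap F z)" "k \<in> hom C (OMap F z) z"
    "k \<cdot> h = Ide C z" "h \<cdot> k = Ide C (OMap F z)"
    "\<And>n. h \<cdot> \<gamma> n = AMap F (\<gamma> n) \<cdot> a n" "\<And>n. k \<cdot> AMap F (\<gamma> n) = \<gamma> (Suc n)"
proof -
  have step': "(a \<circ> Suc) n \<in> hom C ((p \<circ> Suc) n) ((p \<circ> Suc) (Suc n))" for n
    using step by simp
  have Flim': "is_colimit C (seq_of_steps C (p \<circ> Suc) (a \<circ> Suc)) (OMap F z) (\<lambda>n. AMap F (\<gamma> n))"
    using Flim unfolding fcomp_seq_of_steps[of F a p, OF F step p a] .
  have z: "z \<in> Obj C" and leg: "\<gamma> n \<in> hom C (p n) z" for n
    using lim by (auto simp: is_colimit_def is_cocone_def)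
  have comm: "\<gamma> (Suc n) \<cdot> a n = \<gamma> n" for n
    by (rule cocone_seq_of_steps_step[where p = p, OF step]) (use lim in \<open>auto simp: is_colimit_def\<close>)
  have Fz: "OMap F z \<in> Obj C" using is_functorD(1)[OF F z] .
  have Fleg: "AMap F (\<gamma> n) \<in> hom C (p (Suc n)) (OMap F z)" for n
    using is_functorD(2)[OF F leg] p by simp
  \<comment> \<open>This is the image of \<open>comm\<close> under \<open>F\<close>, which turns
    \<open>a n\<close> into \<open>a (Suc n)\<close>.\<close>
  have Fcomm: "AMap F (\<gamma> (Suc n)) \<cdot> a (Suc n) = AMap F (\<gamma> n)" for n
    using is_functorD(4)[OF F step[of n] leg[of "Suc n"]] unfolding a comm by (rule sym)
  have "is_cocone C (seq_of_steps C p a) (OMap F z) (\<lambda>n. AMap F (\<gamma> n) \<cdot> a n)"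
    by (rule is_cocone_seq_of_stepsI[where p = p, OF step Fz])
      (use Comp_in_hom[OF step Fleg] Fcomm in auto)
  then obtain h where h: "h \<in> hom C z (OMap F z)" "\<And>n. h \<cdot> \<gamma> n = AMap F (\<gamma> n) \<cdot> a n"
    using colimit_factor[OF lim] by blast
  have "is_cocone C (seq_of_steps C (p \<circ> Suc) (a \<circ> Suc)) z (\<lambda>n. \<gamma> (Suc n))"
    by (rule is_cocone_seq_of_stepsI[where p = "p \<circ> Suc", OF step' z])
      (use leg comm in auto)
  then obtain k where k: "k \<in> hom C (OMap F z) z" "\<And>n. k \<cdot> AMap F (\<gamma> n) = \<gamma> (Suc n)"
    using colimit_factor[OF Flim'] by blast
  \<comment> \<open>Reassociating twice turns the left side into
    \<open>\<gamma> (Suc n) \<cdot> a n\<close>, which \<open>comm\<close> collapses.\<close>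
  have "(k \<cdot> h) \<cdot> \<gamma> n = Ide C z \<cdot> \<gamma> n" for n
    using Comp_assoc[OF leg h(1) k(1)] Comp_assoc[OF step Fleg k(1)]
    by (simp add: h k comm Comp_Ide_left[OF leg])
  then have kh: "k \<cdot> h = Ide C z"
    by (rule colimit_unique[OF is_sequence_seq_of_steps[where p = p and a = a, OF step] lim
        Comp_in_hom[OF h(1) k(1)] Ide_in_hom[OF z]])
  have "(h \<cdot> k) \<cdot> AMap F (\<gamma> n) = Ide C (OMap F z) \<cdot> AMap F (\<gamma> n)" for n
    using Comp_assoc[OF Fleg k(1) h(1)] by (simp add: h k Fcomm Comp_Ide_left[OF Fleg])
  then have "h \<cdot> k = Ide C (OMap F z)"
    by (rule colimit_unique[OF is_sequence_seq_of_steps[where p = "p \<circ> Suc" and a = "a \<circ> Suc",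
          OF step'] Flim' Comp_in_hom[OF k(1) h(1)] Ide_in_hom[OF Fz]])
  with that h k kh show ?thesis by blast
qed

end

section \<open>Norm estimates for sequences, colimits and iterates\<close>

context normed_category
begin

text \<open>The bounds on the steps telescope, so \<open>r N\<close> dominates every transition
  arrow starting at or after \<open>N\<close>.\<close>

lemma is_Cauchy_seq_of_steps:
  fixes r :: "nat \<Rightarrow> real"
  assumes step: "\<And>n. a n \<in> hom X (p n) (p (Suc n))"
    and nrm: "\<And>n. nrm X (a n) \<le> ennreal (r n - r (Suc n))"
    and r: "decseq r" "r \<longlonglongrightarrow> 0"
  shows "is_Cauchy X (seq_of_steps X p a)"
proof -
  have r_nonneg: "0 \<le> r n" for n using decseq_ge[OF r] .
  have chain: "nrm X (chain X p a m k) \<le> ennreal (r m - r (m + k))" for m k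
  proof (induction k)
    case 0
    show ?case using nrm_Ide[OF Obj_of_hom(1)[OF step]] by simp
  next
    case (Suc k)
    have "nrm X (chain X p a m (Suc k)) \<le> nrm X (chain X p a m k) + nrm X (a (m + k))"
      using nrm_Comp[OF chain_in_hom[where p = p, OF step] step] by simp
    also have "\<dots> \<le> ennreal (r m - r (m + k)) + ennreal (r (m + k) - r (Suc (m + k)))"
      using Suc nrm by (intro add_mono)
    also have "\<dots> = ennreal (r m - r (m + Suc k))"
      using decseqD[OF r(1), of m "m + k"] decseqD[OF r(1), of "m + k" "Suc (m + k)"]
      by (simp flip: ennreal_plus)
    finally show ?case .
  qed
  let ?S = "\<lambda>N. SUP (m, n) \<in> {(m, n). N \<le> m \<and> m \<le> n}. nrm X (AMap (seq_of_steps X p a) (m, n))"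
  have S: "?S N \<le> ennreal (r N)" for N
  proof (rule SUP_least, clarify)
    fix m n assume "N \<le> m" "m \<le> n"
    have "nrm X (chain X p a m (n - m)) \<le> ennreal (r m - r (m + (n - m)))"
      by (rule chain)
    also have "\<dots> \<le> ennreal (r N)"
      using decseqD[OF r(1) \<open>N \<le> m\<close>] r_nonneg[of "m + (n - m)"] by (intro ennreal_leI) linarith
    finally show "nrm X (AMap (seq_of_steps X p a) (m, n)) \<le> ennreal (r N)" by simp
  qed
  have "(INF N. ?S N) \<le> ennreal (r N)" for N
    using INF_lower[of N UNIV ?S] S[of N] by (blast intro: order_trans)
  moreover have "(\<lambda>N. ennreal (r N)) \<longlonglongrightarrow> 0"
    using tendsto_ennrealI[OF r(2)] by simp
  ultimately have "(INF N. ?S N) \<le> 0"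
    by (intro LIMSEQ_le_const) auto
  then show ?thesis
    using is_sequence_seq_of_steps[where p = p, OF step] by (simp add: is_Cauchy_def)
qed

text \<open>The norm formula of a normed colimit is a limsup, so vanishing norm can be tested on the
  legs.\<close>

lemma normed_colimit_nrm_eq_0_iff:
  assumes "is_normed_colimit X s z \<gamma>" and "f \<in> hom X z y"
  shows "nrm X f = 0 \<longleftrightarrow> (\<lambda>n. nrm X (f \<cdot> \<gamma> n)) \<longlonglongrightarrow> 0"
  using assms by (auto simp: is_normed_colimit_def hom_def INF_SUP_eq_0_iff_tendsto_0)

lemma normed_colimit_leg_tendsto_0:
  assumes lim: "is_normed_colimit X s z \<gamma>"
  shows "(\<lambda>n. nrm X (\<gamma> n)) \<longlonglongrightarrow> 0"
proof -
  have z: "z \<in> Obj X" and leg: "\<gamma> n \<in> hom X (OMap s n) z" for n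
    using lim by (auto simp: is_normed_colimit_def is_colimit_def is_cocone_def)
  show ?thesis
    using normed_colimit_nrm_eq_0_iff[OF lim Ide_in_hom[OF z]] nrm_Ide[OF z] Comp_Ide_left[OF leg]
    by simp
qed

text \<open>Restricting \<open>F_nrm\<close> to finite norms keeps \<open>L = 0\<close> away from
  the product \<open>0 * \<infinity>\<close>. The real bound for one iterate supplies the finiteness
  needed for the next.\<close>

lemma contractive_iterate_nrm:
  assumes F: "is_functor X X F" and f: "f \<in> hom X x (OMap F x)" and L: "0 \<le> L"
    and F_nrm: "\<And>h. h \<in> Arr X \<Longrightarrow> nrm X h \<noteq> \<infinity> \<Longrightarrow> nrm X (AMap F h) \<le> ennreal L * nrm X h"
    and fin: "nrm X f < \<infinity>"
  shows "nrm X ((AMap F ^^ n) f) \<le> ennreal (L ^ n * enn2real (nrm X f))"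
proof (induction n)
  case 0
  show ?case using fin by simp
next
  case (Suc n)
  let ?g = "(AMap F ^^ n) f"
  have "?g \<in> Arr X" using iterate_in_hom[OF F f, of n] by (simp add: hom_def)
  moreover have "nrm X ?g \<noteq> \<infinity>" using neq_top_trans[OF _ Suc] by auto
  ultimately have "nrm X (AMap F ?g) \<le> ennreal L * nrm X ?g" by (rule F_nrm)
  also have "\<dots> \<le> ennreal L * ennreal (L ^ n * enn2real (nrm X f))"
    using Suc by (intro mult_left_mono) simp_all
  also have "\<dots> = ennreal (L ^ Suc n * enn2real (nrm X f))"
    using L by (simp add: ennreal_mult' mult.assoc)
  finally show ?case by simp
qed

end

section \<open>Existence of fixed points of a contractive functor\<close>

theorem theorem12p4:
  fixes X :: "('o, 'm) ncat" and F :: "('o, 'm, 'o, 'm) fnctr"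
  assumes "normed_category X"
    and "Cauchy_cocomplete X"
    and "is_functor X X F"
    and "contractive X F"
    and "preserves_sequence_colimits X F"
    and "\<exists>x \<in> Obj X. \<exists>f \<in> hom X x (OMap F x). nrm X f < \<infinity>"
  shows "(\<exists>x. forward_fixed_point X F x) \<and>
         (preserves_Cauchy_normed_colimits X F \<longrightarrow> (\<exists>x. fixed_point X F x)) \<and>
         (forward_symmetric X \<or> backward_symmetric X \<longrightarrow> (\<exists>x. fixed_point X F x))"
proof -
  interpret normed_category X by fact
  note F = assms(3)
  obtain L where L: "0 \<le> L" "L < 1"
    and F_nrm: "\<And>h. h \<in> Arr X \<Longrightarrow>
      nrm X (AMap F h) \<le> (if nrm X h = \<infinity> then \<infinity> else ennreal L * nrm X h)"
    using assms(4) unfolding contractive_def by auto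
  \<comment> \<open>This weaker bound also covers infinite norms, which legs of the colimit may
    have.\<close>
  have F_nrm_le: "nrm X (AMap F h) \<le> nrm X h" if "h \<in> Arr X" for h
  proof -
    have "ennreal L * nrm X h \<le> 1 * nrm X h"
      using L by (intro mult_right_mono) simp_all
    then show ?thesis
      using F_nrm[OF that] order_trans[of "nrm X (AMap F h)" "ennreal L * nrm X h" "nrm X h"]
      by (cases "nrm X h = \<infinity>") simp_all
  qed
  obtain x f where f: "f \<in> hom X x (OMap F x)" "nrm X f < \<infinity>"
    using assms(6) by blast
  define p where "p n = (OMap F ^^ n) x" for n
  define a where "a n = (AMap F ^^ n) f" for n
  define s where "s = seq_of_steps X p a"
  define c where "c = enn2real (nrm X f)"
  have step: "a n \<in> hom X (p n) (p (Suc n))" for n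
    using iterate_in_hom[OF F f(1)] by (simp add: a_def p_def)
  have p: "OMap F (p n) = p (Suc n)" and a: "AMap F (a n) = a (Suc n)" for n
    by (simp_all add: p_def a_def)
  have "nrm X (AMap F h) \<le> ennreal L * nrm X h" if "h \<in> Arr X" "nrm X h \<noteq> \<infinity>" for h
    using F_nrm[OF that(1)] that(2) by simp
  then have a_nrm: "nrm X (a n) \<le> ennreal (L ^ n * c)" for n
    unfolding a_def c_def
    by (rule contractive_iterate_nrm[OF F f(1) L(1) _ f(2)])
  have c: "0 \<le> c" by (simp add: c_def)
  have geometric: "(\<lambda>n. L ^ n) \<longlonglongrightarrow> 0"
    using L by (intro LIMSEQ_realpow_zero)
  have Cauchy: "is_Cauchy X s"
    unfolding s_def
  \<comment> \<open>The choice of \<open>r n\<close> is the tail from \<open>n\<close> on of the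
    geometric series with terms \<open>L ^ i * c\<close>; its consecutive differences are these
    terms.\<close>
  proof (rule is_Cauchy_seq_of_steps[where a = a and p = p and r = "\<lambda>n. L ^ n * (c / (1 - L))", OF step])
    have diff: "L ^ n * q - L ^ Suc n * q = L ^ n * ((1 - L) * q)" for n q
      by (simp add: algebra_simps)
    have "L ^ n * (c / (1 - L)) - L ^ Suc n * (c / (1 - L)) = L ^ n * c" for n
      unfolding diff using L by simp
    then show "nrm X (a n) \<le> ennreal (L ^ n * (c / (1 - L)) - L ^ Suc n * (c / (1 - L)))" for n
      using a_nrm by simp
    show "decseq (\<lambda>n. L ^ n * (c / (1 - L)))"
      using L c by (intro decseq_SucI mult_right_mono power_decreasing) simp_all
    show "(\<lambda>n. L ^ n * (c / (1 - L))) \<longlonglongrightarrow> 0"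
      using geometric by (rule tendsto_mult_left_zero)
  qed
  then obtain z \<gamma> where lim: "is_normed_colimit X s z \<gamma>"
    using assms(2) unfolding Cauchy_cocomplete_def by blast
  then have colim: "is_colimit X s z \<gamma>" by (simp add: is_normed_colimit_def)
  then have Fcolim: "is_colimit X (fcomp F s) (OMap F z) (\<lambda>n. AMap F (\<gamma> n))"
    using assms(5) Cauchy by (simp add: preserves_sequence_colimits_def is_Cauchy_def)
  obtain h k where h: "h \<in> hom X z (OMap F z)" and k: "k \<in> hom X (OMap F z) z"
    and kh: "k \<cdot>\<^bsub>X\<^esub> h = Ide X z" and hk: "h \<cdot>\<^bsub>X\<^esub> k = Ide X (OMap F z)"
    and h_leg: "\<And>n. h \<cdot>\<^bsub>X\<^esub> \<gamma> n = AMap F (\<gamma> n) \<cdot>\<^bsub>X\<^esub> a n"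
    and k_leg: "\<And>n. k \<cdot>\<^bsub>X\<^esub> AMap F (\<gamma> n) = \<gamma> (Suc n)"
    using sequence_colimit_iso[of F a p, OF F step p a colim[unfolded s_def] Fcolim[unfolded s_def]]
    by blast
  have z: "z \<in> Obj X" and leg: "\<gamma> n \<in> hom X (p n) z" for n
    using colim by (auto simp: is_colimit_def is_cocone_def s_def)
  have inv: "inverse_arrows X h k"
    using h k kh hk by (auto simp: inverse_arrows_def hom_def)
  have leg_nrm: "(\<lambda>n. nrm X (\<gamma> n)) \<longlonglongrightarrow> 0"
    using lim by (rule normed_colimit_leg_tendsto_0)
  have "(\<lambda>n. nrm X (h \<cdot>\<^bsub>X\<^esub> \<gamma> n)) \<longlonglongrightarrow> 0"
  proof (rule tendsto_0_ennreal_mono)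
    have "(\<lambda>n. L ^ n * c) \<longlonglongrightarrow> 0"
      using geometric by (rule tendsto_mult_left_zero)
    then have "(\<lambda>n. ennreal (L ^ n * c)) \<longlonglongrightarrow> 0"
      using tendsto_ennrealI by force
    from tendsto_add[OF this leg_nrm]
    show "(\<lambda>n. ennreal (L ^ n * c) + nrm X (\<gamma> n)) \<longlonglongrightarrow> 0" by simp
    \<comment> \<open>Here \<open>a n\<close> accounts for the geometric term, while
      \<open>F\<close> does not increase the norm of the leg.\<close>
    have "nrm X (h \<cdot>\<^bsub>X\<^esub> \<gamma> n) \<le> ennreal (L ^ n * c) + nrm X (\<gamma> n)" for n
    proof -
      have "AMap F (\<gamma> n) \<in> hom X (p (Suc n)) (OMap F z)"
        using is_functorD(2)[OF F leg] p by simp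
      from nrm_Comp[OF step this]
      have "nrm X (h \<cdot>\<^bsub>X\<^esub> \<gamma> n) \<le> nrm X (a n) + nrm X (AMap F (\<gamma> n))"
        by (simp add: h_leg)
      also have "\<dots> \<le> ennreal (L ^ n * c) + nrm X (\<gamma> n)"
        using a_nrm F_nrm_le leg[of n] by (intro add_mono) (simp_all add: hom_def)
      finally show ?thesis .
    qed
    then show "\<forall>\<^sub>F n in sequentially. nrm X (h \<cdot>\<^bsub>X\<^esub> \<gamma> n) \<le> ennreal (L ^ n * c) + nrm X (\<gamma> n)"
      by simp
  qed
  then have h_nrm: "nrm X h = 0"
    using normed_colimit_nrm_eq_0_iff[OF lim h] by simp
  have "forward_fixed_point X F z"
    using z h inv h_nrm by (auto simp: forward_fixed_point_def iso_arr_def)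
  moreover have fixed: "fixed_point X F z" if "nrm X k = 0"
    using z h inv h_nrm that by (auto simp: fixed_point_def)
  moreover have "nrm X k = 0" if "preserves_Cauchy_normed_colimits X F"
  proof -
    have "is_normed_colimit X (fcomp F s) (OMap F z) (\<lambda>n. AMap F (\<gamma> n))"
      using that Cauchy lim by (simp add: preserves_Cauchy_normed_colimits_def)
    then show ?thesis
      \<comment> \<open>Composing \<open>k\<close> with the \<open>n\<close>-th leg gives
        \<open>\<gamma> (Suc n)\<close>, hence the shifted limit.\<close>
      using normed_colimit_nrm_eq_0_iff[OF _ k] k_leg LIMSEQ_Suc[OF leg_nrm] by simp
  qed
  moreover have "nrm X k = 0" if "forward_symmetric X \<or> backward_symmetric X"
  proof -
    \<comment> \<open>Forward symmetry is applied to \<open>h\<close> followed by \<open>k\<close>,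
      backward symmetry to \<open>k\<close> followed by \<open>h\<close>; both composites are
      identities.\<close>
    have "nrm X k \<le> nrm X (k \<cdot>\<^bsub>X\<^esub> h) + nrm X h \<or> nrm X k \<le> nrm X (h \<cdot>\<^bsub>X\<^esub> k) + nrm X h"
      using that h k by (auto simp: forward_symmetric_def backward_symmetric_def hom_def)
    then show ?thesis
      using kh hk h_nrm nrm_Ide z is_functorD(1)[OF F z] by auto
  qed
  ultimately show ?thesis by blast
qed

end
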